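(* Let $K$ be a field with $\mathrm{char}\,K=0$ and let $n\geq 1$. If $\varphi\in G_\infty(n,K)$ is periodic, then $\mathrm{ord}(\varphi)=\mathrm{ord}(\varphi_1)$.
   Context: Every $\varphi\in K[[x_1,\dots,x_n]]^n$ has a unique homogeneous decomposition $\varphi=\sum_{k=0}^\infty\varphi_k$, where $\varphi_k$ is an $n$-tuple of homogeneous polynomials of degree $k$. $G_\infty(n,K)$ is the set of all $\varphi\in K[[x_1,\dots,x_n]]^n$ with $\varphi_0=0$ and $\varphi_1\in GL_n(K)$ (an $n$-tuple of linear forms $\left(\sum_j a_{1j}x_j,\dots,\sum_j a_{nj}x_j\right)$ is identified with the matrix $(a_{ij})$). It is a group under composition $\varphi\phi=\varphi\circ\phi=(f_1(\phi),\dots,f_n(\phi))$ for $\varphi=(f_1,\dots,f_n)$, with identity $id=(x_1,\dots,x_n)$. A series in $G_\infty(n,K)$ is periodic if its order in this group is finite. $\mathrm{ord}(\varphi)$ denotes the order of $\varphi$ in $G_\infty(n,K)$ and $\mathrm{ord}(\varphi_1)$ the order of $\varphi_1$ in $GL_n(K)$. *)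

theory Defs
  imports "HOL-Analysis.Cartesian_Space" "HOL-Algebra.Multiplicative_Group"
begin

text \<open>
  The variables are indexed by a finite type \<open>'n\<close>; the multi-index \<open>m\<close> stands for the
  monomial \<open>\<Prod>i. x\<^sub>i ^ (m $ i)\<close>.
\<close>

typedef ('a, 'n) mfps = "UNIV :: (nat ^ 'n::finite \<Rightarrow> 'a) set"
  morphisms mcoeff Abs_mfps
  by simp

setup_lifting type_definition_mfps

lemma mfps_eq_iff: "f = g \<longleftrightarrow> (\<forall>m. mcoeff f m = mcoeff g m)"
  by (simp add: mcoeff_inject [symmetric] fun_eq_iff)

definition antidiag :: "nat ^ 'n::finite \<Rightarrow> ((nat ^ 'n) \<times> (nat ^ 'n)) set" where
  "antidiag m = {(a, b). a + b = m}"

lemma finite_multiindex_le: "finite {a :: nat ^ 'n::finite. a \<le> m}"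
proof (rule finite_imageD)
  have "vec_nth ` {a. a \<le> m} \<subseteq> PiE UNIV (\<lambda>i. {..m $ i})"
    by (auto simp: less_eq_vec_def)
  then show "finite (vec_nth ` {a. a \<le> m})"
    by (rule finite_subset) (auto intro!: finite_PiE)
  show "inj_on vec_nth {a. a \<le> m}"
    by (auto simp: inj_on_def vec_eq_iff)
qed

lemma finite_antidiag [simp]: "finite (antidiag m)"
proof -
  have "antidiag m \<subseteq> {a. a \<le> m} \<times> {a. a \<le> m}"
    by (auto simp: antidiag_def less_eq_vec_def)
  then show ?thesis
    by (rule finite_subset) (simp add: finite_multiindex_le)
qed

instantiation mfps :: (comm_ring_1, finite) comm_ring_1
begin

lift_definition zero_mfps :: "('a, 'b) mfps" is "\<lambda>m. 0" .

lift_definition one_mfps :: "('a, 'b) mfps" is "\<lambda>m. if m = 0 then 1 else 0" .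

lift_definition plus_mfps :: "('a, 'b) mfps \<Rightarrow> ('a, 'b) mfps \<Rightarrow> ('a, 'b) mfps"
  is "\<lambda>f g m. f m + g m" .

lift_definition uminus_mfps :: "('a, 'b) mfps \<Rightarrow> ('a, 'b) mfps"
  is "\<lambda>f m. - f m" .

lift_definition minus_mfps :: "('a, 'b) mfps \<Rightarrow> ('a, 'b) mfps \<Rightarrow> ('a, 'b) mfps"
  is "\<lambda>f g m. f m - g m" .

lift_definition times_mfps :: "('a, 'b) mfps \<Rightarrow> ('a, 'b) mfps \<Rightarrow> ('a, 'b) mfps"
  is "\<lambda>f g m. \<Sum>(a, b)\<in>antidiag m. f a * g b" .

instance
proof
  fix f g h :: "('a, 'b) mfps"
  show "f * g * h = f * (g * h)"
    unfolding mfps_eq_iff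
  proof
    fix m
    have "mcoeff (f * g * h) m =
        (\<Sum>(p, c)\<in>antidiag m. \<Sum>(a, b)\<in>antidiag p. mcoeff f a * mcoeff g b * mcoeff h c)"
      by (simp add: times_mfps.rep_eq sum_distrib_right split_def)
    also have "\<dots> = (\<Sum>((p, c), (a, b))\<in>(SIGMA (p, c):antidiag m. antidiag p).
        mcoeff f a * mcoeff g b * mcoeff h c)"
      by (subst sum.Sigma [symmetric]) (auto simp: split_def)
    also have "\<dots> = (\<Sum>((a, q), (b, c))\<in>(SIGMA (a, q):antidiag m. antidiag q).
        mcoeff f a * mcoeff g b * mcoeff h c)"
      by (rule sum.reindex_bij_witness
          [where i = "\<lambda>((a, q), (b, c)). ((a + b, c), (a, b))"
             and j = "\<lambda>((p, c), (a, b)). ((a, b + c), (b, c))"])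
        (auto simp: antidiag_def add.assoc)
    also have "\<dots> =
        (\<Sum>(a, q)\<in>antidiag m. \<Sum>(b, c)\<in>antidiag q. mcoeff f a * mcoeff g b * mcoeff h c)"
      by (subst sum.Sigma [symmetric]) (auto simp: split_def)
    also have "\<dots> = mcoeff (f * (g * h)) m"
      by (simp add: times_mfps.rep_eq sum_distrib_left split_def mult.assoc)
    finally show "mcoeff (f * g * h) m = mcoeff (f * (g * h)) m" .
  qed
  show "f * g = g * f"
    unfolding mfps_eq_iff times_mfps.rep_eq
    by (intro allI, rule sum.reindex_bij_witness [where i = prod.swap and j = prod.swap])
      (auto simp: antidiag_def add.commute mult.commute)
  show "1 * f = f"
    unfolding mfps_eq_iff
  proof
    fix m
    have "mcoeff (1 * f) m =
        (\<Sum>x\<in>antidiag m. if x = (0, m) then mcoeff f m else 0)"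
      unfolding times_mfps.rep_eq one_mfps.rep_eq
      by (rule sum.cong) (auto simp: antidiag_def split: if_splits)
    also have "\<dots> = mcoeff f m"
      by (subst sum.delta [OF finite_antidiag]) (simp add: antidiag_def)
    finally show "mcoeff (1 * f) m = mcoeff f m" .
  qed
  show "(f + g) * h = f * h + g * h"
    by (simp add: mfps_eq_iff times_mfps.rep_eq plus_mfps.rep_eq split_def
        distrib_right sum.distrib)
  have "mcoeff (0 :: ('a, 'b) mfps) 0 \<noteq> mcoeff 1 0"
    by (simp add: zero_mfps.rep_eq one_mfps.rep_eq)
  then show "(0 :: ('a, 'b) mfps) \<noteq> 1"
    by metis
qed (simp_all add: mfps_eq_iff zero_mfps.rep_eq plus_mfps.rep_eq uminus_mfps.rep_eq
      minus_mfps.rep_eq add.assoc add.commute)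

end

lift_definition mvar :: "'n::finite \<Rightarrow> ('a::comm_ring_1, 'n) mfps"
  is "\<lambda>i m. if m = axis i 1 then 1 else 0" .

definition mdeg :: "nat ^ 'n::finite \<Rightarrow> nat" where
  "mdeg m = (\<Sum>i\<in>UNIV. m $ i)"

text \<open>
  \<open>msubst f \<psi>\<close> is \<open>f(\<psi>)\<close>, the sum of \<open>mcoeff f m * \<psi> ^ m\<close> over all multi-indices \<open>m\<close>.  If the
  components of \<open>\<psi>\<close> have no constant term, then \<open>\<psi> ^ m\<close> has no terms of degree below
  \<open>mdeg m\<close>, so only the finitely many \<open>m\<close> with \<open>mdeg m \<le> mdeg e\<close> contribute to the
  coefficient at \<open>e\<close>.  If some component has a nonzero constant term, the value is meaningless.
\<close>

lift_definition msubst ::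
    "('a::comm_ring_1, 'n::finite) mfps \<Rightarrow> ('a, 'k::finite) mfps ^ 'n \<Rightarrow> ('a, 'k) mfps"
  is "\<lambda>f \<psi> e. \<Sum>m | mdeg m \<le> mdeg e. f m * mcoeff (\<Prod>i\<in>UNIV. (\<psi> $ i) ^ (m $ i)) e" .


lift_definition hom_part ::
    "nat \<Rightarrow> ('a::comm_ring_1, 'n::finite) mfps \<Rightarrow> ('a, 'n) mfps"
  is "\<lambda>k f m. if mdeg m = k then f m else 0" .

definition hom_component ::
    "nat \<Rightarrow> ('a::comm_ring_1, 'n::finite) mfps ^ 'n \<Rightarrow> ('a, 'n) mfps ^ 'n" where
  "hom_component k \<phi> = (\<chi> i. hom_part k (\<phi> $ i))"

definition matrix_of_forms :: "('a::comm_ring_1, 'n::finite) mfps ^ 'n \<Rightarrow> 'a ^ 'n ^ 'n" where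
  "matrix_of_forms \<psi> = (\<chi> i j. mcoeff (\<psi> $ i) (axis j 1))"

abbreviation linear_part :: "('a::comm_ring_1, 'n::finite) mfps ^ 'n \<Rightarrow> 'a ^ 'n ^ 'n" where
  "linear_part \<phi> \<equiv> matrix_of_forms (hom_component 1 \<phi>)"

definition GL :: "('a::field ^ 'n::finite ^ 'n) monoid" where
  "GL = \<lparr>carrier = {A. invertible A}, monoid.mult = (**), one = mat 1\<rparr>"

definition G_infty :: "(('a::field, 'n::finite) mfps ^ 'n) monoid" where
  "G_infty =
    \<lparr>carrier = {\<phi>. hom_component 0 \<phi> = 0 \<and> linear_part \<phi> \<in> carrier GL},
     monoid.mult = (\<lambda>\<phi> \<psi>. \<chi> i. msubst (\<phi> $ i) \<psi>),
     one = (\<chi> i. mvar i)\<rparr>"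

text \<open>\<^const>\<open>group.ord\<close> is \<open>0\<close> exactly for the elements of infinite order.\<close>

definition periodic :: "('a::field, 'n::finite) mfps ^ 'n \<Rightarrow> bool" where
  "periodic \<phi> \<longleftrightarrow> \<phi> \<in> carrier G_infty \<and> group.ord G_infty \<phi> \<noteq> 0"

end

(* In a component i, telescoping g = phi_i - x_i along phi^0, ..., phi^(k-1) shows that phi^k = id
   forces the sum of the g(phi^j), j < k, to vanish.  If phi is tangent to the identity, each
   g(phi^j) has the same leading form as g, so k times that leading form is 0, and g = 0 in
   characteristic 0.  Hence the kernel of phi |-> phi_1 is torsion free; applied to phi^d with
   d = ord(phi_1), this gives ord(phi) dvd d. *)

theory Submission
  imports Defs
begin

text \<open>As a simp rule, \<open>1 = Suc 0\<close> would rewrite inside \<open>linear_part\<close> and block \<open>linear_part_nth\<close>.\<close>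

declare One_nat_def [simp del]

section \<open>Coefficients and degrees\<close>

lemmas mcoeff_simps [simp] =
  zero_mfps.rep_eq plus_mfps.rep_eq minus_mfps.rep_eq one_mfps.rep_eq

lemma mcoeff_mult: "mcoeff (f * g) m = (\<Sum>(a, b)\<in>antidiag m. mcoeff f a * mcoeff g b)"
  by (simp add: times_mfps.rep_eq)

lemma mcoeff_sum: "mcoeff (sum f S) m = (\<Sum>i\<in>S. mcoeff (f i) m)"
  by (induction S rule: infinite_finite_induct) auto

lemma mdeg_0 [simp]: "mdeg 0 = 0"
  by (simp add: mdeg_def)

lemma mdeg_add [simp]: "mdeg (a + b) = mdeg a + mdeg b"
  by (simp add: mdeg_def sum.distrib)

lemma mdeg_axis [simp]: "mdeg (axis i k) = k"
  by (simp add: mdeg_def axis_def)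

lemma mdeg_eq_0_iff [simp]: "mdeg m = 0 \<longleftrightarrow> m = 0"
  by (auto simp: mdeg_def vec_eq_iff)

lemma nth_le_mdeg: "m $ i \<le> mdeg m"
  unfolding mdeg_def by (rule member_le_sum) auto

lemma finite_mdeg_le [simp]: "finite {m :: nat ^ 'n::finite. mdeg m \<le> k}"
proof (rule finite_subset)
  show "{m :: nat ^ 'n. mdeg m \<le> k} \<subseteq> {m. m \<le> (\<chi> i. k)}"
    using nth_le_mdeg by (auto simp: less_eq_vec_def intro: order_trans)
qed (rule finite_multiindex_le)

lemma sum_axis: "(\<Sum>i\<in>UNIV. axis i (m $ i)) = (m :: nat ^ 'n::finite)"
  by (simp add: vec_eq_iff axis_def)

lemma mdeg_eq_1_iff: "mdeg m = 1 \<longleftrightarrow> (\<exists>i. m = axis i 1)"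
proof
  assume "mdeg m = 1"
  then obtain i where i: "m $ i = 1" "\<And>j. j \<noteq> i \<Longrightarrow> m $ j = 0"
    unfolding mdeg_def by (subst (asm) sum_eq_1_iff) auto
  then have "m = axis i 1"
    by (auto simp: vec_eq_iff axis_def)
  then show "\<exists>i. m = axis i 1" ..
qed auto

section \<open>The order filtration\<close>

text \<open>Membership in the \<open>k\<close>-th power of the ideal of series without constant
  term. Stated as a bound rather than as an order function, it needs no special value for the zero
  series.\<close>

definition mord_ge :: "nat \<Rightarrow> ('a::comm_ring_1, 'n::finite) mfps \<Rightarrow> bool" where
  "mord_ge k f \<longleftrightarrow> (\<forall>m. mdeg m < k \<longrightarrow> mcoeff f m = 0)"

lemma mord_ge_0 [simp]: "mord_ge 0 f"
  by (simp add: mord_ge_def)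

lemma mord_ge_zero [simp]: "mord_ge k 0"
  by (simp add: mord_ge_def)

lemma mord_ge_add: "mord_ge k f \<Longrightarrow> mord_ge k g \<Longrightarrow> mord_ge k (f + g)"
  by (simp add: mord_ge_def)

lemma mord_ge_diff: "mord_ge k f \<Longrightarrow> mord_ge k g \<Longrightarrow> mord_ge k (f - g)"
  by (simp add: mord_ge_def)

lemma mord_ge_sum: "(\<And>i. i \<in> S \<Longrightarrow> mord_ge k (f i)) \<Longrightarrow> mord_ge k (sum f S)"
  by (simp add: mord_ge_def mcoeff_sum)

lemma mord_ge_mult:
  fixes f g :: "('a::comm_ring_1, 'n::finite) mfps"
  assumes "mord_ge j f" "mord_ge k g"
  shows "mord_ge (j + k) (f * g)"
  unfolding mord_ge_def mcoeff_mult
proof (intro allI impI sum.neutral ballI, clarify)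
  fix m a b :: "nat ^ 'n" assume "mdeg m < j + k" "(a, b) \<in> antidiag m"
  then have "mdeg a < j \<or> mdeg b < k"
    by (auto simp: antidiag_def)
  then show "mcoeff f a * mcoeff g b = 0"
    using assms by (auto simp: mord_ge_def)
qed

text \<open>The filtration is separated: the coefficient at \<open>m\<close> is already decided by
  the bound \<open>mdeg m + 1\<close>.\<close>

lemma eq_if_mord_ge_diff:
  assumes "\<And>k. mord_ge k (f - g)"
  shows "f = g"
  unfolding mfps_eq_iff
proof
  fix m
  show "mcoeff f m = mcoeff g m"
    using assms [of "Suc (mdeg m)"] by (simp add: mord_ge_def)
qed

text \<open>Equality of the homogeneous parts of degree \<open>k\<close> of two series of order at
  least \<open>k\<close>. Both parts may be zero, so \<open>k\<close> need not be the exact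
  order.\<close>

definition same_leading :: "nat \<Rightarrow> ('a::comm_ring_1, 'n::finite) mfps \<Rightarrow> ('a, 'n) mfps \<Rightarrow> bool" where
  "same_leading k f g \<longleftrightarrow> mord_ge k f \<and> mord_ge k g \<and> mord_ge (Suc k) (f - g)"

lemma same_leading_one: "same_leading 0 1 1"
  by (simp add: same_leading_def)

text \<open>In the splitting of \<open>f * g - f' * g'\<close> below, each summand contains one
  difference, which gains a degree, and one factor of the expected order.\<close>

lemma same_leading_mult:
  assumes "same_leading j f f'" "same_leading k g g'"
  shows "same_leading (j + k) (f * g) (f' * g')"
proof -
  have "f * g - f' * g' = (f - f') * g + f' * (g - g')"
    by (simp add: algebra_simps)
  moreover have "mord_ge (Suc j + k) ((f - f') * g)" "mord_ge (j + Suc k) (f' * (g - g'))"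
    using assms unfolding same_leading_def by (blast intro: mord_ge_mult)+
  ultimately have "mord_ge (Suc (j + k)) (f * g - f' * g')"
    by (simp add: mord_ge_add)
  with assms show ?thesis
    unfolding same_leading_def by (blast intro: mord_ge_mult)
qed

lemma same_leading_power:
  assumes "same_leading j f g"
  shows "same_leading (j * k) (f ^ k) (g ^ k)"
proof (induction k)
  case (Suc k)
  then show ?case
    using same_leading_mult [OF assms Suc.IH] by simp
qed (simp add: same_leading_one)

lemma same_leading_prod:
  assumes "\<And>i. i \<in> S \<Longrightarrow> same_leading (k i) (f i) (g i)"
  shows "same_leading (sum k S) (prod f S) (prod g S)"
  using assms
  by (induction S rule: infinite_finite_induct) (auto simp: same_leading_one same_leading_mult)

section \<open>Monomials\<close>

definition mpow :: "('a::comm_ring_1, 'k::finite) mfps ^ 'n::finite \<Rightarrow> nat ^ 'n \<Rightarrow> ('a, 'k) mfps" where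
  "mpow \<psi> m = (\<Prod>i\<in>UNIV. (\<psi> $ i) ^ (m $ i))"

text \<open>The condition under which \<open>msubst\<close> is genuine substitution: the terms cut
  off in its definition then contribute nothing.\<close>

definition no_const :: "('a::comm_ring_1, 'k::finite) mfps ^ 'n::finite \<Rightarrow> bool" where
  "no_const \<psi> \<longleftrightarrow> (\<forall>i. mcoeff (\<psi> $ i) 0 = 0)"

abbreviation mid :: "('a::comm_ring_1, 'n::finite) mfps ^ 'n" where
  "mid \<equiv> (\<chi> i. mvar i)"

lemma mpow_0 [simp]: "mpow \<psi> 0 = 1"
  by (simp add: mpow_def)

lemma mpow_add: "mpow \<psi> (a + b) = mpow \<psi> a * mpow \<psi> b"
  by (simp add: mpow_def power_add prod.distrib)

lemma mpow_axis: "mpow \<psi> (axis i k) = (\<psi> $ i) ^ k"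
proof -
  have "mpow \<psi> (axis i k) = (\<Prod>j\<in>UNIV. if j = i then (\<psi> $ j) ^ k else 1)"
    unfolding mpow_def by (rule prod.cong) (auto simp: axis_def)
  then show ?thesis by simp
qed

lemma no_const_iff_mord_ge: "no_const \<psi> \<longleftrightarrow> (\<forall>i. mord_ge 1 (\<psi> $ i))"
  by (simp add: no_const_def mord_ge_def)

text \<open>The factor with index \<open>i\<close> has order at least \<open>m $ i\<close>, and
  these bounds add up to \<open>mdeg m\<close>.\<close>

lemma same_leading_mpow:
  assumes "\<And>i. same_leading 1 (\<psi> $ i) (\<theta> $ i)"
  shows "same_leading (mdeg m) (mpow \<psi> m) (mpow \<theta> m)"
  unfolding mpow_def mdeg_def
  by (rule same_leading_prod) (use same_leading_power [OF assms] in simp)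

lemma mord_ge_mpow:
  assumes "no_const \<psi>"
  shows "mord_ge (mdeg m) (mpow \<psi> m)"
  using same_leading_mpow [of \<psi> \<psi> m] assms
  by (simp add: same_leading_def no_const_iff_mord_ge)

lemma mcoeff_mpow_eq_0: "no_const \<psi> \<Longrightarrow> mdeg e < mdeg m \<Longrightarrow> mcoeff (mpow \<psi> m) e = 0"
  using mord_ge_mpow [of \<psi> m] by (simp add: mord_ge_def)

section \<open>Monomials as power series\<close>

lift_definition monomial :: "nat ^ 'n::finite \<Rightarrow> ('a::comm_ring_1, 'n) mfps"
  is "\<lambda>m e. if e = m then 1 else 0" .

lemma mvar_eq_monomial: "mvar i = monomial (axis i 1)"
  by (simp add: mfps_eq_iff mvar.rep_eq monomial.rep_eq)

lemma monomial_0 [simp]: "monomial 0 = 1"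
  by (simp add: mfps_eq_iff monomial.rep_eq)

lemma monomial_add:
  "monomial (a + b) = (monomial a * monomial b :: ('a::comm_ring_1, 'n::finite) mfps)"
  unfolding mfps_eq_iff
proof
  fix m :: "nat ^ 'n"
  have "mcoeff (monomial a * monomial b :: ('a, 'n) mfps) m
      = (\<Sum>x\<in>antidiag m. if x = (a, b) then 1 else (0 :: 'a))"
    unfolding mcoeff_mult monomial.rep_eq by (rule sum.cong) (auto split: if_splits)
  also have "\<dots> = mcoeff (monomial (a + b)) m"
    by (subst sum.delta [OF finite_antidiag]) (auto simp: antidiag_def monomial.rep_eq)
  finally show "mcoeff (monomial (a + b)) m = mcoeff (monomial a * monomial b :: ('a, 'n) mfps) m" ..
qed

lemma monomial_sum: "monomial (sum f S) = (\<Prod>i\<in>S. monomial (f i))"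
  by (induction S rule: infinite_finite_induct) (auto simp: monomial_add)

lemma mvar_power: "mvar i ^ k = (monomial (axis i k) :: ('a::comm_ring_1, 'n::finite) mfps)"
proof (induction k)
  case 0
  have "axis i 0 = (0 :: nat ^ 'n)" by (simp add: vec_eq_iff axis_def)
  then show ?case by (simp only: power_0 monomial_0)
next
  case (Suc k)
  have "axis i (Suc k) = axis i 1 + axis i k" by (simp add: vec_eq_iff axis_def)
  then show ?case by (simp only: monomial_add power_Suc Suc) (simp only: mvar_eq_monomial)
qed

lemma mpow_mid: "mpow mid m = monomial m"
  by (simp add: mpow_def mvar_power flip: monomial_sum) (simp add: sum_axis)

lemma mcoeff_mvar_0 [simp]: "mcoeff (mvar i) 0 = 0"
  by (auto simp: mvar.rep_eq vec_eq_iff axis_def)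

lemma no_const_mid [simp]: "no_const mid"
  by (simp add: no_const_def)

section \<open>Substitution\<close>

text \<open>The cutoff \<open>mdeg e\<close> can be raised to any \<open>k\<close>, since
  \<open>mpow \<psi> m\<close> has no terms below degree \<open>mdeg m\<close>. Coefficients at
  different \<open>e\<close> can thus be summed over one common range.\<close>

lemma mcoeff_msubst:
  assumes "no_const \<psi>" "mdeg e \<le> k"
  shows "mcoeff (msubst f \<psi>) e = (\<Sum>m | mdeg m \<le> k. mcoeff f m * mcoeff (mpow \<psi> m) e)"
  unfolding msubst.rep_eq mpow_def [symmetric]
  by (rule sum.mono_neutral_left) (use assms in \<open>auto simp: mcoeff_mpow_eq_0\<close>)

lemma msubst_add: "msubst (f + g) \<psi> = msubst f \<psi> + msubst g \<psi>"
  by (simp add: mfps_eq_iff msubst.rep_eq distrib_right sum.distrib)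

lemma msubst_diff: "msubst (f - g) \<psi> = msubst f \<psi> - msubst g \<psi>"
  by (simp add: mfps_eq_iff msubst.rep_eq left_diff_distrib sum_subtractf)

text \<open>Continuity of substitution in \<open>f\<close>: this lets it pass to the limit of a
  coefficientwise stabilizing sequence.\<close>

lemma mcoeff_msubst_cong:
  assumes "\<And>m. mdeg m \<le> mdeg e \<Longrightarrow> mcoeff f m = mcoeff g m"
  shows "mcoeff (msubst f \<psi>) e = mcoeff (msubst g \<psi>) e"
  using assms by (simp add: msubst.rep_eq)

lemma msubst_monomial:
  fixes \<psi> :: "('a::comm_ring_1, 'k::finite) mfps ^ 'n::finite"
  assumes "no_const \<psi>"
  shows "msubst (monomial m) \<psi> = mpow \<psi> m"
  unfolding mfps_eq_iff
proof
  fix e :: "nat ^ 'k"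
  \<comment> \<open>The range must contain \<open>m\<close> even when
    \<open>mdeg e < mdeg m\<close>, so that the sum collapses to its term at
    \<open>m\<close>.\<close>
  let ?k = "max (mdeg e) (mdeg m)"
  have "mcoeff (msubst (monomial m) \<psi>) e
      = (\<Sum>l | mdeg l \<le> ?k. if l = m then mcoeff (mpow \<psi> m) e else 0)"
    unfolding mcoeff_msubst [OF assms max.cobounded1 [of "mdeg e" "mdeg m"]] monomial.rep_eq by (rule sum.cong) auto
  also have "\<dots> = mcoeff (mpow \<psi> m) e"
    by (subst sum.delta) auto
  finally show "mcoeff (msubst (monomial m) \<psi>) e = mcoeff (mpow \<psi> m) e" .
qed

lemma msubst_mvar: "no_const \<psi> \<Longrightarrow> msubst (mvar i) \<psi> = \<psi> $ i"
  by (simp add: mvar_eq_monomial msubst_monomial mpow_axis)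

lemma msubst_one: "no_const \<psi> \<Longrightarrow> msubst 1 \<psi> = 1"
  using msubst_monomial [of \<psi> 0] by simp

lemma msubst_mid: "msubst f mid = f"
  unfolding mfps_eq_iff msubst.rep_eq mpow_def [symmetric] mpow_mid monomial.rep_eq
  by (simp add: if_distrib cong: if_cong)

text \<open>Both products expand into sums over pairs \<open>(p, q)\<close> of exponents, to be
  regrouped by \<open>p + q\<close>. The work lies in matching the two truncations.\<close>

lemma msubst_mult:
  fixes \<psi> :: "('a::comm_ring_1, 'k::finite) mfps ^ 'n::finite"
  assumes "no_const \<psi>"
  shows "msubst (f * g) \<psi> = msubst f \<psi> * msubst g \<psi>"
  unfolding mfps_eq_iff
proof
  fix e :: "nat ^ 'k"
  let ?D = "{m. mdeg m \<le> mdeg e}"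
  let ?t = "\<lambda>p q. mcoeff f p * mcoeff g q * mcoeff (mpow \<psi> (p + q)) e"
  have "mcoeff (msubst f \<psi> * msubst g \<psi>) e
      = (\<Sum>(a, b)\<in>antidiag e. (\<Sum>p\<in>?D. mcoeff f p * mcoeff (mpow \<psi> p) a) *
          (\<Sum>q\<in>?D. mcoeff g q * mcoeff (mpow \<psi> q) b))"
    unfolding mcoeff_mult
    by (rule sum.cong) (auto simp: antidiag_def mcoeff_msubst [OF assms, of _ "mdeg e"])
  also have "\<dots> = (\<Sum>(a, b)\<in>antidiag e. \<Sum>(p, q)\<in>?D \<times> ?D.
      mcoeff f p * mcoeff g q * (mcoeff (mpow \<psi> p) a * mcoeff (mpow \<psi> q) b))"
    by (simp add: sum_product sum.cartesian_product split_def mult_ac)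
  \<comment> \<open>After exchanging the sums, the inner one is the coefficient at \<open>e\<close>
    of \<open>mpow \<psi> p * mpow \<psi> q\<close>.\<close>
  also have "\<dots> = (\<Sum>(p, q)\<in>?D \<times> ?D. ?t p q)"
    unfolding split_def mpow_add mcoeff_mult sum_distrib_left by (rule sum.swap)
  \<comment> \<open>Pairs of total degree above \<open>mdeg e\<close> drop out because
    \<open>mpow \<psi> (p + q)\<close> has too high an order.\<close>
  also have "\<dots> = (\<Sum>(p, q)\<in>{(p, q). mdeg (p + q) \<le> mdeg e}. ?t p q)"
  proof (rule sum.mono_neutral_right)
    show "\<forall>x\<in>?D \<times> ?D - {(p, q). mdeg (p + q) \<le> mdeg e}. (case x of (p, q) \<Rightarrow> ?t p q) = 0"
      using mcoeff_mpow_eq_0 [OF assms, of e] leI by (fastforce simp del: mdeg_add)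
  qed auto
  also have "\<dots> = (\<Sum>(m, p, q)\<in>(SIGMA m:?D. antidiag m). ?t p q)"
    by (rule sum.reindex_bij_witness
        [where i = "\<lambda>(m, p, q). (p, q)" and j = "\<lambda>(p, q). (p + q, p, q)"])
      (auto simp: antidiag_def)
  also have "\<dots> = (\<Sum>m\<in>?D. \<Sum>(p, q)\<in>antidiag m. ?t p q)"
    by (subst sum.Sigma [symmetric]) auto
  also have "\<dots> = (\<Sum>m\<in>?D. mcoeff (f * g) m * mcoeff (mpow \<psi> m) e)"
    unfolding mcoeff_mult sum_distrib_right
    by (intro sum.cong) (auto simp: antidiag_def)
  also have "\<dots> = mcoeff (msubst (f * g) \<psi>) e"
    by (simp add: mcoeff_msubst [OF assms order_refl])
  finally show "mcoeff (msubst (f * g) \<psi>) e = mcoeff (msubst f \<psi> * msubst g \<psi>) e" ..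
qed

lemma msubst_power: "no_const \<psi> \<Longrightarrow> msubst (f ^ k) \<psi> = msubst f \<psi> ^ k"
  by (induction k) (auto simp: msubst_one msubst_mult)

lemma msubst_prod: "no_const \<psi> \<Longrightarrow> msubst (prod f S) \<psi> = (\<Prod>i\<in>S. msubst (f i) \<psi>)"
  by (induction S rule: infinite_finite_induct) (auto simp: msubst_one msubst_mult)

section \<open>Composition of tuples and its associativity\<close>

definition mcomp :: "('a::comm_ring_1, 'n::finite) mfps ^ 'k::finite \<Rightarrow> ('a, 'm::finite) mfps ^ 'n
    \<Rightarrow> ('a, 'm) mfps ^ 'k" where
  "mcomp \<phi> \<psi> = (\<chi> i. msubst (\<phi> $ i) \<psi>)"

lemma mcomp_nth [simp]: "mcomp \<phi> \<psi> $ i = msubst (\<phi> $ i) \<psi>"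
  by (simp add: mcomp_def)

lemma msubst_mpow: "no_const \<theta> \<Longrightarrow> msubst (mpow \<psi> m) \<theta> = mpow (mcomp \<psi> \<theta>) m"
  by (simp add: mpow_def msubst_prod msubst_power)

text \<open>The cutoff at degree 0 leaves only \<open>m = 0\<close>, whose power product is
  1.\<close>

lemma mcoeff_msubst_0 [simp]: "mcoeff (msubst f \<psi>) 0 = mcoeff f 0"
  by (simp add: msubst.rep_eq flip: mpow_def)

lemma no_const_mcomp: "no_const \<phi> \<Longrightarrow> no_const (mcomp \<phi> \<psi>)"
  by (simp add: no_const_def)

text \<open>Substituting \<open>\<theta>\<close> is multiplicative, so it turns
  \<open>mpow \<psi> m\<close> into \<open>mpow (mcomp \<psi> \<theta>) m\<close>. With all sums cut
  off at \<open>mdeg e\<close>, the rest is an exchange of finite sums.\<close>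

lemma msubst_msubst:
  fixes \<psi> :: "('a::comm_ring_1, 'k::finite) mfps ^ 'n::finite"
    and \<theta> :: "('a, 'm::finite) mfps ^ 'k"
  assumes "no_const \<psi>" "no_const \<theta>"
  shows "msubst (msubst f \<psi>) \<theta> = msubst f (mcomp \<psi> \<theta>)"
  unfolding mfps_eq_iff
proof
  fix e :: "nat ^ 'm"
  let ?D = "{m. mdeg m \<le> mdeg e}"
  have "mcoeff (msubst (msubst f \<psi>) \<theta>) e
      = (\<Sum>p\<in>?D. (\<Sum>m\<in>?D. mcoeff f m * mcoeff (mpow \<psi> m) p) * mcoeff (mpow \<theta> p) e)"
    unfolding mcoeff_msubst [OF assms(2) order_refl]
    by (intro sum.cong) (auto simp: mcoeff_msubst [OF assms(1), of _ "mdeg e"])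
  also have "\<dots> = (\<Sum>m\<in>?D. mcoeff f m * (\<Sum>p\<in>?D. mcoeff (mpow \<psi> m) p * mcoeff (mpow \<theta> p) e))"
    unfolding sum_distrib_left sum_distrib_right mult.assoc by (rule sum.swap)
  also have "\<dots> = (\<Sum>m\<in>?D. mcoeff f m * mcoeff (mpow (mcomp \<psi> \<theta>) m) e)"
    by (simp add: msubst_mpow [OF assms(2), symmetric] mcoeff_msubst [OF assms(2) order_refl])
  also have "\<dots> = mcoeff (msubst f (mcomp \<psi> \<theta>)) e"
    by (simp add: mcoeff_msubst [OF no_const_mcomp [OF assms(1)] order_refl])
  finally show "mcoeff (msubst (msubst f \<psi>) \<theta>) e = mcoeff (msubst f (mcomp \<psi> \<theta>)) e" .
qed

lemma mcomp_assoc: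
  "no_const \<psi> \<Longrightarrow> no_const \<theta> \<Longrightarrow> mcomp (mcomp \<phi> \<psi>) \<theta> = mcomp \<phi> (mcomp \<psi> \<theta>)"
  by (simp add: vec_eq_iff msubst_msubst)

lemma mcomp_mid_left: "no_const \<psi> \<Longrightarrow> mcomp mid \<psi> = \<psi>"
  by (simp add: vec_eq_iff msubst_mvar)

section \<open>Linear parts\<close>

lemma linear_part_nth: "linear_part \<phi> $ i $ j = mcoeff (\<phi> $ i) (axis j 1)"
  by (simp add: matrix_of_forms_def hom_component_def hom_part.rep_eq)

lemma hom_component_0_iff:
  fixes \<phi> :: "('a::comm_ring_1, 'b::finite) mfps ^ 'b"
  shows "hom_component 0 \<phi> = 0 \<longleftrightarrow> no_const \<phi>"
proof -
  have "(\<forall>m. (if mdeg m = 0 then c m else 0) = 0) \<longleftrightarrow> c 0 = 0"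
    for c :: "nat ^ 'b \<Rightarrow> 'a" by auto
  then show ?thesis
    unfolding hom_component_def no_const_def vec_eq_iff mfps_eq_iff by (simp add: hom_part.rep_eq)
qed

lemma linear_part_mid: "linear_part mid = mat 1"
  by (intro vec_eq_iff [THEN iffD2] allI)
    (simp add: linear_part_nth mvar.rep_eq mat_def axis_eq_axis)

lemma linear_part_mcomp:
  fixes \<phi> \<psi> :: "('a::comm_ring_1, 'n::finite) mfps ^ 'n"
  assumes "no_const \<phi>" "no_const \<psi>"
  shows "linear_part (mcomp \<phi> \<psi>) = linear_part \<phi> ** linear_part \<psi>"
proof -
  have "mcoeff (msubst (\<phi> $ i) \<psi>) (axis j 1)
      = (\<Sum>k\<in>UNIV. mcoeff (\<phi> $ i) (axis k 1) * mcoeff (\<psi> $ k) (axis j 1))" for i j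
  proof -
    have "mcoeff (msubst (\<phi> $ i) \<psi>) (axis j 1)
        = (\<Sum>m | mdeg m \<le> 1. mcoeff (\<phi> $ i) m * mcoeff (mpow \<psi> m) (axis j 1))"
      using assms(2) by (intro mcoeff_msubst) auto
    \<comment> \<open>Besides the unit vectors, only \<open>m = 0\<close> has degree at most 1, and
      its term vanishes because \<open>\<phi>\<close> has no constant term.\<close>
    also have "\<dots> = (\<Sum>m\<in>range (\<lambda>k. axis k 1).
        mcoeff (\<phi> $ i) m * mcoeff (mpow \<psi> m) (axis j 1))"
    proof (rule sum.mono_neutral_right)
      show "\<forall>m\<in>{m. mdeg m \<le> 1} - range (\<lambda>k. axis k 1).
          mcoeff (\<phi> $ i) m * mcoeff (mpow \<psi> m) (axis j 1) = 0"
      proof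
        fix m :: "nat ^ 'n"
        assume "m \<in> {m. mdeg m \<le> 1} - range (\<lambda>k. axis k 1)"
        then have "mdeg m \<le> 1" "mdeg m \<noteq> 1" by (auto simp: mdeg_eq_1_iff)
        then have "mdeg m = 0" by linarith
        then have "m = 0" by simp
        then show "mcoeff (\<phi> $ i) m * mcoeff (mpow \<psi> m) (axis j 1) = 0"
          using assms(1) by (simp add: no_const_def)
      qed
    qed auto
    also have "\<dots> = (\<Sum>k\<in>UNIV. mcoeff (\<phi> $ i) (axis k 1) * mcoeff (\<psi> $ k) (axis j 1))"
      by (subst sum.reindex) (auto simp: inj_on_def axis_eq_axis mpow_axis)
    finally show ?thesis .
  qed
  then show ?thesis
    by (simp add: vec_eq_iff linear_part_nth matrix_matrix_mult_def)
qed

text \<open>Substituting a tuple tangent to the identity preserves leading forms, because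
  \<open>mpow \<psi> m\<close> starts with the monomial \<open>m\<close> itself. Both the
  construction of inverses and the torsion argument rest on this.\<close>

lemma mord_ge_msubst_diff:
  fixes \<psi> :: "('a::comm_ring_1, 'n::finite) mfps ^ 'n"
  assumes "no_const \<psi>" "linear_part \<psi> = mat 1" "mord_ge k f"
  shows "mord_ge (Suc k) (msubst f \<psi> - f)"
  unfolding mord_ge_def
proof (intro allI impI)
  fix e :: "nat ^ 'n"
  assume e: "mdeg e < Suc k"
  \<comment> \<open>Either \<open>m\<close> lies below the order of \<open>f\<close>, or
    \<open>mdeg e \<le> mdeg m\<close> and only the leading form of \<open>mpow \<psi> m\<close> can
    be seen at \<open>e\<close>.\<close>
  have *: "mcoeff f m = 0 \<or> mcoeff (mpow \<psi> m) e = mcoeff (mpow mid m) e"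
    if "mdeg m \<le> mdeg e" for m
  proof (cases "mdeg m < k")
    case True
    then show ?thesis using assms(3) by (simp add: mord_ge_def)
  next
    case False
    with e that have "mdeg e < Suc (mdeg m)" by simp
    moreover have "same_leading 1 (\<psi> $ i) (mid $ i)" for i
    proof -
      have "mcoeff (\<psi> $ i) m = mcoeff (mvar i) m" if "mdeg m < 2" for m
      proof (cases "m = 0")
        case True
        then show ?thesis using assms(1) by (simp add: no_const_def)
      next
        case False
        with that have "mdeg m = 1"
          by (metis One_nat_def less_2_cases mdeg_eq_0_iff)
        then obtain j where m: "m = axis j 1"
          unfolding mdeg_eq_1_iff ..
        have "mcoeff (\<psi> $ i) (axis j 1) = mcoeff (mid $ i) (axis j 1)"
          by (simp only: linear_part_nth [symmetric] assms(2) linear_part_mid)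
        then show ?thesis by (simp add: m)
      qed
      then show ?thesis
        using assms(1) no_const_mid
        by (auto simp: same_leading_def no_const_iff_mord_ge mord_ge_def)
    qed
    then have "same_leading (mdeg m) (mpow \<psi> m) (mpow mid m)"
      by (rule same_leading_mpow)
    ultimately show ?thesis
      by (simp add: same_leading_def mord_ge_def)
  qed
  \<comment> \<open>Writing \<open>f\<close> as \<open>msubst f mid\<close> allows a comparison term
    by term.\<close>
  have "mcoeff (msubst f \<psi>) e = mcoeff (msubst f mid) e"
    unfolding msubst.rep_eq mpow_def [symmetric]
    by (intro sum.cong refl) (use * in fastforce)
  then show "mcoeff (msubst f \<psi> - f) e = 0"
    by (simp add: msubst_mid)
qed

section \<open>Inverses\<close>

text \<open>
  With \<open>N f = f - msubst f \<psi>\<close>, substitution of \<open>\<psi>\<close> is inverted by the Neumann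
  series \<open>\<Sum>j. N ^ j\<close>, which is locally finite because \<open>N\<close> raises the order.
\<close>

lemma msubst_surj_unipotent:
  assumes "no_const \<psi>" "linear_part \<psi> = mat 1"
  obtains g where "msubst g \<psi> = f"
proof -
  define N where "N g = g - msubst g \<psi>" for g
  define S where "S k = (\<Sum>j<k. (N ^^ j) f)" for k
  have N_ord: "mord_ge k ((N ^^ k) f)" for k
  proof (induction k)
    case (Suc k)
    then have "mord_ge (Suc k) (0 - (msubst ((N ^^ k) f) \<psi> - (N ^^ k) f))"
      by (intro mord_ge_diff mord_ge_msubst_diff assms) auto
    then show ?case by (simp add: N_def [of "(N ^^ k) f"])
  qed simp
  \<comment> \<open>Since \<open>msubst h \<psi> = h - N h\<close>, the images of the partial sums
    telescope.\<close>
  have S_subst: "msubst (S k) \<psi> = f - (N ^^ k) f" for k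
  proof (induction k)
    case 0
    have "msubst 0 \<psi> = 0" by (simp add: mfps_eq_iff msubst.rep_eq)
    then show ?case by (simp add: S_def)
  next
    case (Suc k)
    have "msubst (S (Suc k)) \<psi> = msubst (S k) \<psi> + msubst ((N ^^ k) f) \<psi>"
      by (simp add: S_def msubst_add)
    then show ?case by (simp add: Suc N_def [of "(N ^^ k) f"])
  qed
  \<comment> \<open>Terms with \<open>j > mdeg m\<close> have order above \<open>mdeg m\<close>, so
    the coefficient at \<open>m\<close> is final after \<open>mdeg m + 1\<close> terms.\<close>
  have S_stable: "mcoeff (S (Suc (mdeg m))) m = mcoeff (S k) m" if "mdeg m < k" for m k
    unfolding S_def mcoeff_sum
    by (rule sum.mono_neutral_left)
      (use that N_ord in \<open>auto simp: mord_ge_def\<close>)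
  \<comment> \<open>The limit of the partial sums, read off coefficient by coefficient.\<close>
  define g where "g = Abs_mfps (\<lambda>m. mcoeff (S (Suc (mdeg m))) m)"
  have g: "mcoeff g m = mcoeff (S (Suc (mdeg m))) m" for m
    by (simp add: g_def Abs_mfps_inverse)
  have "mcoeff (msubst g \<psi>) e = mcoeff f e" for e
  proof -
    have "mcoeff (msubst g \<psi>) e = mcoeff (msubst (S (Suc (mdeg e))) \<psi>) e"
      by (rule mcoeff_msubst_cong) (simp add: g S_stable)
    then show ?thesis
      using N_ord [of "Suc (mdeg e)"] by (simp add: S_subst mord_ge_def del: funpow.simps)
  qed
  then have "msubst g \<psi> = f" by (simp add: mfps_eq_iff)
  then show thesis by (rule that)
qed

section \<open>Linear tuples and left inverses\<close>

lift_definition linear_form :: "'a::comm_ring_1 ^ 'n::finite \<Rightarrow> ('a, 'n) mfps"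
  is "\<lambda>v m. \<Sum>j\<in>UNIV. if m = axis j 1 then v $ j else 0" .

definition linear_series :: "'a::comm_ring_1 ^ 'n::finite ^ 'k::finite \<Rightarrow> ('a, 'n) mfps ^ 'k" where
  "linear_series A = (\<chi> i. linear_form (A $ i))"

lemma linear_part_linear_series: "linear_part (linear_series A) = A"
  by (intro vec_eq_iff [THEN iffD2] allI)
    (simp add: linear_part_nth linear_series_def linear_form.rep_eq axis_eq_axis)

lemma no_const_linear_series: "no_const (linear_series A)"
proof -
  have "(0 :: nat ^ 'b) \<noteq> axis j 1" for j by (metis mdeg_0 mdeg_axis zero_neq_one)
  then show ?thesis
    by (simp add: no_const_def linear_series_def linear_form.rep_eq)
qed

lemma mcomp_left_inverse_unipotent:
  fixes \<psi> :: "('a::field, 'n::finite) mfps ^ 'n"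
  assumes "no_const \<psi>" "linear_part \<psi> = mat 1"
  obtains \<theta> where "mcomp \<theta> \<psi> = mid" "no_const \<theta>" "linear_part \<theta> = mat 1"
proof -
  have "\<exists>g. msubst g \<psi> = mvar i" for i
    using msubst_surj_unipotent [OF assms] by blast
  then obtain g where g: "\<And>i. msubst (g i) \<psi> = mvar i" by metis
  let ?\<theta> = "\<chi> i. g i"
  have inv: "mcomp ?\<theta> \<psi> = mid" by (simp add: vec_eq_iff g)
  \<comment> \<open>Substitution leaves the constant coefficient unchanged, so \<open>g i\<close>
    inherits that of \<open>mvar i\<close>.\<close>
  have nc: "no_const ?\<theta>"
    unfolding no_const_def by (metis vec_lambda_beta g mcoeff_msubst_0 mcoeff_mvar_0)
  have "linear_part ?\<theta> = mat 1"
    using linear_part_mcomp [OF nc assms(1)] by (simp add: inv linear_part_mid assms(2))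
  with inv nc show thesis by (rule that)
qed

section \<open>The groups\<close>

lemma group_GL: "group (GL :: ('a::field ^ 'n::finite ^ 'n) monoid)"
proof (rule groupI)
  fix A :: "'a ^ 'n ^ 'n"
  assume "A \<in> carrier GL"
  then obtain B where "A ** B = mat 1" "B ** A = mat 1"
    by (auto simp: GL_def invertible_def)
  then show "\<exists>B\<in>carrier GL. B \<otimes>\<^bsub>GL\<^esub> A = \<one>\<^bsub>GL\<^esub>"
    by (auto simp: GL_def invertible_def)
next
  show "\<one>\<^bsub>GL\<^esub> \<in> carrier (GL :: ('a ^ 'n ^ 'n) monoid)"
    by (auto simp: GL_def invertible_def intro: exI [of _ "mat 1"])
qed (auto simp: GL_def invertible_mult matrix_mul_assoc)

lemma carrier_G_infty:
  "\<phi> \<in> carrier G_infty \<longleftrightarrow> no_const \<phi> \<and> linear_part \<phi> \<in> carrier GL"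
  by (simp add: G_infty_def hom_component_0_iff)

lemma mult_G_infty [simp]: "\<phi> \<otimes>\<^bsub>G_infty\<^esub> \<psi> = mcomp \<phi> \<psi>"
  by (simp add: G_infty_def mcomp_def)

lemma one_G_infty [simp]: "\<one>\<^bsub>G_infty\<^esub> = mid"
  by (simp add: G_infty_def)

lemma mult_GL: "A \<otimes>\<^bsub>GL\<^esub> B = A ** B"
  by (simp add: GL_def)

lemma one_GL: "\<one>\<^bsub>GL\<^esub> = mat 1"
  by (simp add: GL_def)

text \<open>Left inverses suffice. Composing with the linear tuple \<open>?L\<close> of the inverse
  matrix makes \<open>\<phi>\<close> tangent to the identity; if \<open>\<theta>\<close> is a left
  inverse of the result, then \<open>mcomp \<theta> ?L\<close> is one of
  \<open>\<phi>\<close>.\<close>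

lemma group_G_infty: "group (G_infty :: (('a::field, 'n::finite) mfps ^ 'n) monoid)"
proof -
  interpret GL: group "GL :: ('a ^ 'n ^ 'n) monoid" by (rule group_GL)
  show ?thesis
  proof (rule groupI)
    fix \<phi> \<psi> :: "('a, 'n) mfps ^ 'n"
    assume "\<phi> \<in> carrier G_infty" "\<psi> \<in> carrier G_infty"
    then show "\<phi> \<otimes>\<^bsub>G_infty\<^esub> \<psi> \<in> carrier G_infty"
      using GL.m_closed
      by (auto simp: carrier_G_infty no_const_mcomp linear_part_mcomp simp flip: mult_GL)
  next
    show "\<one>\<^bsub>G_infty\<^esub> \<in> carrier (G_infty :: (('a, 'n) mfps ^ 'n) monoid)"
      using GL.one_closed by (simp add: carrier_G_infty linear_part_mid one_GL)
  next
    fix \<phi> :: "('a, 'n) mfps ^ 'n"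
    assume "\<phi> \<in> carrier G_infty"
    then have \<phi>: "no_const \<phi>" "linear_part \<phi> \<in> carrier GL"
      by (simp_all add: carrier_G_infty)
    define B where "B = inv\<^bsub>GL\<^esub> linear_part \<phi>"
    have B: "B \<in> carrier GL" "B ** linear_part \<phi> = mat 1"
      using GL.inv_closed [OF \<phi>(2)] GL.l_inv [OF \<phi>(2)]
      by (simp_all add: B_def mult_GL one_GL)
    let ?L = "linear_series B"
    have "no_const (mcomp ?L \<phi>)" "linear_part (mcomp ?L \<phi>) = mat 1"
      by (simp_all add: no_const_mcomp no_const_linear_series linear_part_mcomp \<phi>
          linear_part_linear_series B)
    then obtain \<theta> where \<theta>: "mcomp \<theta> (mcomp ?L \<phi>) = mid" "no_const \<theta>" "linear_part \<theta> = mat 1"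
      by (rule mcomp_left_inverse_unipotent)
    have "mcomp (mcomp \<theta> ?L) \<phi> = mid"
      by (simp add: mcomp_assoc no_const_linear_series \<phi> \<theta>)
    moreover have "mcomp \<theta> ?L \<in> carrier G_infty"
      by (simp add: carrier_G_infty no_const_mcomp no_const_linear_series linear_part_mcomp \<theta>
          linear_part_linear_series B)
    ultimately show "\<exists>\<psi>\<in>carrier G_infty. \<psi> \<otimes>\<^bsub>G_infty\<^esub> \<phi> = \<one>\<^bsub>G_infty\<^esub>"
      by auto
  qed (auto simp: carrier_G_infty mcomp_assoc mcomp_mid_left)
qed

section \<open>The linear part as a homomorphism, torsion in its kernel, and orders\<close>

lemma linear_part_hom:
  "linear_part \<in> hom (G_infty :: (('a::field, 'n::finite) mfps ^ 'n) monoid) GL"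
  by (auto simp: hom_def carrier_G_infty linear_part_mcomp mult_GL)

lemma unipotent_torsion_free:
  fixes \<phi> :: "('a::field_char_0, 'n::finite) mfps ^ 'n" and k :: nat
  assumes \<phi>: "\<phi> \<in> carrier G_infty" "linear_part \<phi> = mat 1"
    and k: "k > 0" "\<phi> [^]\<^bsub>G_infty\<^esub> k = \<one>\<^bsub>G_infty\<^esub>"
  shows "\<phi> = \<one>\<^bsub>G_infty\<^esub>"
proof -
  interpret G: group "G_infty :: (('a, 'n) mfps ^ 'n) monoid" by (rule group_G_infty)
  interpret GL: group "GL :: ('a ^ 'n ^ 'n) monoid" by (rule group_GL)
  interpret H: group_hom G_infty "GL :: ('a ^ 'n ^ 'n) monoid" linear_part
    by unfold_locales (rule linear_part_hom)
  define P where "P j = \<phi> [^]\<^bsub>G_infty\<^esub> (j :: nat)" for j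
  have P_nc: "no_const (P j)" for j
    using G.nat_pow_closed [OF \<phi>(1), of j] by (simp add: P_def carrier_G_infty)
  have P_lin: "linear_part (P j) = mat 1" for j
    using H.hom_nat_pow [OF \<phi>(1), of j] GL.nat_pow_one [of j] by (simp add: P_def \<phi> one_GL)
  \<comment> \<open>The new factor goes on the left, so that component \<open>i\<close> of
    \<open>P (Suc j)\<close> is \<open>\<phi> $ i\<close> evaluated at \<open>P j\<close>; this is
    what makes the sum below telescope.\<close>
  have P_Suc: "P (Suc j) = mcomp \<phi> (P j)" for j
    using G.nat_pow_Suc2 [OF \<phi>(1), of j] by (simp add: P_def)
  have "\<phi> $ i = mvar i" for i
  proof (rule eq_if_mord_ge_diff)
    fix r
    define g where "g = \<phi> $ i - mvar i"
    \<comment> \<open>The summand with index \<open>j\<close> equals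
      \<open>P (Suc j) $ i - P j $ i\<close>.\<close>
    have "(\<Sum>j<l. msubst g (P j)) = P l $ i - mvar i" for l
    proof (induction l)
      case 0
      show ?case by (simp add: P_def)
    next
      case (Suc l)
      then show ?case by (simp add: P_Suc g_def msubst_diff msubst_mvar P_nc)
    qed
    then have sum0: "(\<Sum>j<k. msubst g (P j)) = 0"
      using k(2) by (simp add: P_def)
    show "mord_ge r g"
    proof (induction r)
      case (Suc r)
      \<comment> \<open>By the induction hypothesis \<open>g\<close> has order at least
        \<open>r\<close>, so each summand gains a degree. As the substituted series sum to 0,
        \<open>k\<close> times \<open>g\<close> has order at least \<open>r + 1\<close>.\<close>
      have "mord_ge (Suc r) (\<Sum>j<k. msubst g (P j) - g)"
        by (intro mord_ge_sum mord_ge_msubst_diff P_nc P_lin Suc)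
      then have *: "mord_ge (Suc r) (0 - (\<Sum>j<k. g))"
        by (simp only: sum_subtractf sum0)
      have "mcoeff g m = 0" if "mdeg m < Suc r" for m
      proof -
        have "mcoeff (0 - (\<Sum>j<k. g)) m = 0"
          using * that unfolding mord_ge_def by blast
        then have "of_nat k * mcoeff g m = 0"
          unfolding minus_mfps.rep_eq zero_mfps.rep_eq mcoeff_sum by simp
        \<comment> \<open>Characteristic 0 enters here: \<open>of_nat k\<close> is nonzero for
          \<open>k > 0\<close>.\<close>
        then show ?thesis using k(1) by simp
      qed
      then show ?case by (simp add: mord_ge_def)
    qed simp
  qed
  then show ?thesis by (simp add: vec_eq_iff)
qed

theorem theorem1:
  fixes \<phi> :: "('a::field_char_0, 'n::finite) mfps ^ 'n"
  assumes "\<phi> \<in> carrier G_infty"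
    and "periodic \<phi>"
  shows "group.ord G_infty \<phi> = group.ord GL (linear_part \<phi>)"
proof -
  interpret G: group "G_infty :: (('a, 'n) mfps ^ 'n) monoid" by (rule group_G_infty)
  interpret GL: group "GL :: ('a ^ 'n ^ 'n) monoid" by (rule group_GL)
  interpret H: group_hom G_infty "GL :: ('a ^ 'n ^ 'n) monoid" linear_part
    by unfold_locales (rule linear_part_hom)
  let ?A = "linear_part \<phi>"
  have A: "?A \<in> carrier GL" using assms(1) by (rule H.hom_closed)
  let ?d = "GL.ord ?A"
  have "?d dvd G.ord \<phi>"
  proof (subst GL.pow_eq_id [OF A, symmetric])
    have "?A [^]\<^bsub>GL\<^esub> G.ord \<phi> = linear_part (\<phi> [^]\<^bsub>G_infty\<^esub> G.ord \<phi>)"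
      by (rule H.hom_nat_pow [OF assms(1), symmetric])
    also have "\<dots> = \<one>\<^bsub>GL\<^esub>"
      by (simp only: G.pow_ord_eq_1 [OF assms(1)] H.hom_one)
    finally show "?A [^]\<^bsub>GL\<^esub> G.ord \<phi> = \<one>\<^bsub>GL\<^esub>" .
  qed
  \<comment> \<open>No separate case for \<open>?d = 0\<close> is required: then
    \<open>?\<psi>\<close> is the identity and everything divides 0. The other divisibility, with
    \<open>G.ord \<phi>\<close> nonzero, excludes this value in the end.\<close>
  moreover have "G.ord \<phi> dvd ?d"
  proof -
    let ?\<psi> = "\<phi> [^]\<^bsub>G_infty\<^esub> ?d"
    have "linear_part ?\<psi> = mat 1"
      by (simp only: H.hom_nat_pow [OF assms(1)] GL.pow_ord_eq_1 [OF A] one_GL)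
    moreover have "G.ord \<phi> > 0"
      using assms(2) by (simp add: periodic_def)
    \<comment> \<open>Periodicity of \<open>\<phi>\<close> makes its power \<open>?\<psi>\<close> a
      torsion element, and \<open>?\<psi>\<close> lies in the kernel of the linear part, hence it is
      the identity.\<close>
    moreover have "?\<psi> [^]\<^bsub>G_infty\<^esub> G.ord \<phi> = \<one>\<^bsub>G_infty\<^esub>"
      by (simp only: G.nat_pow_pow [OF assms(1)] G.pow_eq_id [OF assms(1)] dvd_triv_right)
    ultimately have "?\<psi> = \<one>\<^bsub>G_infty\<^esub>"
      by (rule unipotent_torsion_free [OF G.nat_pow_closed [OF assms(1)]])
    then show ?thesis
      by (simp only: G.pow_eq_id [OF assms(1)])
  qed
  ultimately show ?thesis by (rule dvd_antisym [rotated])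
qed

end
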